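(* If the parameter $\xi$ satisfies $$\xi\in\left(0,\ \frac1{n_x}\min\left\{\frac1{\kappa_{\mathrm{tr}_1}},\ \frac{\min_{j\in[n_x]}(x_{U,j}-x_{L,j})}{2\Delta_{\max}}\right\}\right],$$ then any call to the procedure \textsc{AddDirection} (described in the context) adds to $\mathcal{D}_k$ a vector $d\in\mathbb{R}^{n_x}$ satisfying $$\left\|\mathrm{proj}_Z\!\left(\frac{d}{\Delta_k}\right)\right\|_2\ge\xi,\qquad \|d\|_{\mathrm{tr}}\le\Delta_k,\qquad x_k+d\in\Omega,$$ where $Z$ is the matrix given as input to the call.
   Context: Setting. $\Omega=[x_L,x_U]\subseteq\mathbb{R}^{n_x}$ with $x_L\in(\mathbb{R}\cup\{-\infty\})^{n_x}$, $x_U\in(\mathbb{R}\cup\{\infty\})^{n_x}$, $x_{L,j}<x_{U,j}$ for all $j$; $x_k\in\Omega$; $0<\Delta_k\le\Delta_{\max}<\infty$; $\mathrm{tr}\ge1$ is real, $\|\cdot\|_{\mathrm{tr}}$ is the $\ell_{\mathrm{tr}}$-norm, and $\kappa_{\mathrm{tr}_1}>0$ is a constant with $\|v\|_{\mathrm{tr}}\le\kappa_{\mathrm{tr}_1}\|v\|_2$ for all $v\in\mathbb{R}^{n_x}$. $[n]=\{1,\dots,n\}$. Input of \textsc{AddDirection}: a finite set $\mathcal{D}_k\subset\mathbb{R}^{n_x}$ containing $0$, and $Z=[z_1\cdots z_{n_z}]\in\mathbb{R}^{n_x\times n_z}$ with orthonormal columns spanning the orthogonal complement of $\mathrm{span}(\mathcal{D}_k)$,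 with $n_z\ge1$. $\mathrm{proj}_Z$ is the orthogonal projection onto the column space of $Z$ (so $\|\mathrm{proj}_Z(d)\|_2=\|Z^Td\|_2$), and $\Upsilon(Z,d)=\|Z^Td\|_2^2$. For $v\in\mathbb{R}^{n_x}$ define $\bar\tau(v)\in[0,\infty]^{n_x}$ by $\bar\tau_j(v)=(x_{U,j}-x_{k,j})/v_j$ if $v_j>0$ and $x_{U,j}<\infty$; $\bar\tau_j(v)=(x_{L,j}-x_{k,j})/v_j$ if $v_j<0$ and $x_{L,j}>-\infty$; $\bar\tau_j(v)=\infty$ otherwise. For $\tau\in[0,\infty]$ let $d(v,\tau)$ have components $\min\{\tau,\bar\tau_j(v)\}v_j$ (so for finite $\tau$, $x_k+d(v,\tau)$ is the projection of $x_k+\tau v$ onto $\Omega$). Conventions: $0\times\infty=0$, $\pm a\times\infty=\pm\infty$ for $a>0$, and a vector with an infinite component has norm $\infty$. \textsc{OptStep}$(Z,v,\bar\tau)$ with $\bar\tau=\bar\tau(v)$: put $\bar\tau_{(0)}=0$ and sort the distinct positive values among $\bar\tau_1,\dots,\bar\tau_{n_x}$ as $0<\bar\tau_{(1)}<\dots<\bar\tau_{(\hat n_x)}$ (if there are none, $\hat n_x=0$ and $0$ is returned). If $\|d(v,\bar\tau_{(\hat n_x)})\|_{\mathrm{tr}}\le\Delta_k$, return a maximizer of $\Upsilon(Z,d(v,\tau))$ over $\tau\in\{\bar\tau_{(1)},\dots,\bar\tau_{(\hat n_x)}\}$. Otherwise find $\hat j\in[\hat n_x]$ with $\|d(v,\bar\tau_{(\hat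 j-1)})\|_{\mathrm{tr}}\le\Delta_k\le\|d(v,\bar\tau_{(\hat j)})\|_{\mathrm{tr}}$, find $\hat\tau\in[\bar\tau_{(\hat j-1)},\bar\tau_{(\hat j)}]$ with $\|d(v,\hat\tau)\|_{\mathrm{tr}}=\Delta_k$, and return a maximizer of $\Upsilon(Z,d(v,\tau))$ over $\tau\in\{\bar\tau_{(1)},\dots,\bar\tau_{(\hat j-1)}\}\cup\{\hat\tau\}$. \textsc{AddDirection}$(\mathcal{D}_k,Z)$: set $d\leftarrow0$. For $i=1,\dots,n_z$: compute $\tau^+\leftarrow$\textsc{OptStep}$(Z,z_i,\bar\tau(z_i))$ and, if $\Upsilon(Z,d(z_i,\tau^+))>\Upsilon(Z,d)$, set $d\leftarrow d(z_i,\tau^+)$; compute $\tau^-\leftarrow$\textsc{OptStep}$(Z,-z_i,\bar\tau(-z_i))$ and, if $\Upsilon(Z,d(-z_i,\tau^-))>\Upsilon(Z,d)$, set $d\leftarrow d(-z_i,\tau^-)$. Finally add $d$ to $\mathcal{D}_k$ and recompute $Z$. *)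

theory Defs
  imports "HOL-Analysis.Analysis"
begin

text \<open>
  A matrix \<open>Z\<close> with \<open>n\<^sub>z\<close> columns in \<open>real ^ 'n\<close> is represented by the list of its columns, since
  \<open>n\<^sub>z\<close> drops when \<open>Z\<close> is recomputed and may become 0.

  Vectors with components in \<open>[-\<infinity>, \<infinity>]\<close> have type \<open>ereal ^ 'n\<close>. Multiplication on \<^typ>\<open>ereal\<close> obeys
  \<open>0 * \<infinity> = 0\<close> and \<open>\<plusminus>a * \<infinity> = \<plusminus>\<infinity>\<close> for \<open>a > 0\<close>.
\<close>

definition box_domain :: "ereal ^ 'n \<Rightarrow> ereal ^ 'n \<Rightarrow> (real ^ 'n) set" where
  "box_domain xL xU = {x. \<forall>j. xL $ j \<le> ereal (x $ j) \<and> ereal (x $ j) \<le> xU $ j}"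

definition lp_norm :: "real \<Rightarrow> real ^ 'n \<Rightarrow> real" where
  "lp_norm p v = (\<Sum>j\<in>UNIV. \<bar>v $ j\<bar> powr p) powr (1 / p)"

definition ereal_vec :: "real ^ 'n \<Rightarrow> ereal ^ 'n" where
  "ereal_vec v = (\<chi> j. ereal (v $ j))"

definition real_vec :: "ereal ^ 'n \<Rightarrow> real ^ 'n" where
  "real_vec v = (\<chi> j. real_of_ereal (v $ j))"

text \<open>
  Norms are extended by the value \<open>\<infinity>\<close> to vectors with an infinite component. The same extension is
  used for \<open>\<Upsilon>(Z, _)\<close>; \<open>opt_step\<close> never has to compare \<open>\<Upsilon>\<close> at such a vector.
\<close>
definition extend_inf :: "(real ^ 'n \<Rightarrow> real) \<Rightarrow> ereal ^ 'n \<Rightarrow> ereal" where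
  "extend_inf f v = (if \<forall>j. \<bar>v $ j\<bar> \<noteq> \<infinity> then ereal (f (real_vec v)) else \<infinity>)"

definition orthonormal_columns :: "(real ^ 'n) list \<Rightarrow> bool" where
  "orthonormal_columns Z \<longleftrightarrow>
     (\<forall>i<length Z. \<forall>j<length Z. Z ! i \<bullet> Z ! j = (if i = j then 1 else 0))"

definition orthonormal_complement :: "(real ^ 'n) set \<Rightarrow> (real ^ 'n) list \<Rightarrow> bool" where
  "orthonormal_complement D Z \<longleftrightarrow>
     orthonormal_columns Z \<and> span (set Z) = orthogonal_comp (span D)"

definition orth_proj :: "(real ^ 'n) list \<Rightarrow> real ^ 'n \<Rightarrow> real ^ 'n" where
  "orth_proj Z d = (THE p. p \<in> span (set Z) \<and> (\<forall>w\<in>span (set Z). orthogonal (d - p) w))"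

text \<open>The entries of \<open>Z\<^sup>T d\<close> are the inner products \<open>z \<bullet> d\<close>, so this is \<open>\<parallel>Z\<^sup>T d\<parallel>\<^sub>2\<^sup>2\<close>.\<close>
definition Upsilon :: "(real ^ 'n) list \<Rightarrow> real ^ 'n \<Rightarrow> real" where
  "Upsilon Z d = (\<Sum>z\<leftarrow>Z. (z \<bullet> d)\<^sup>2)"

definition tau_bar :: "ereal ^ 'n \<Rightarrow> ereal ^ 'n \<Rightarrow> real ^ 'n \<Rightarrow> real ^ 'n \<Rightarrow> 'n \<Rightarrow> ereal" where
  "tau_bar xL xU x v j =
     (if v $ j > 0 \<and> xU $ j < \<infinity> then (xU $ j - ereal (x $ j)) / ereal (v $ j)
      else if v $ j < 0 \<and> xL $ j > -\<infinity> then (xL $ j - ereal (x $ j)) / ereal (v $ j)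
      else \<infinity>)"

text \<open>The vector \<open>d(v, \<tau>)\<close>.\<close>
definition proj_step ::
  "ereal ^ 'n \<Rightarrow> ereal ^ 'n \<Rightarrow> real ^ 'n \<Rightarrow> real ^ 'n \<Rightarrow> ereal \<Rightarrow> ereal ^ 'n" where
  "proj_step xL xU x v \<tau> = (\<chi> j. min \<tau> (tau_bar xL xU x v j) * ereal (v $ j))"

text \<open>
  \<open>breakpoints xL xU x v ! j\<close> is the sorted value with index \<open>j\<close>, the entry of index 0 being 0.
\<close>
definition breakpoints :: "ereal ^ 'n \<Rightarrow> ereal ^ 'n \<Rightarrow> real ^ 'n \<Rightarrow> real ^ 'n \<Rightarrow> ereal list" where
  "breakpoints xL xU x v = 0 # sorted_list_of_set {t \<in> range (tau_bar xL xU x v). 0 < t}"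

text \<open>
  The procedures are nondeterministic (choice of \<open>\<hat>j\<close>, of \<open>\<hat>\<tau>\<close>, of a maximizer and of the recomputed
  \<open>Z\<close>), so they are given as relations between inputs and possible results.
\<close>
definition opt_step ::
  "ereal ^ 'n \<Rightarrow> ereal ^ 'n \<Rightarrow> real ^ 'n \<Rightarrow> real \<Rightarrow> real \<Rightarrow> (real ^ 'n) list \<Rightarrow> real ^ 'n \<Rightarrow> ereal \<Rightarrow> bool"
  where
  "opt_step xL xU x tr \<Delta> Z v \<tau> \<longleftrightarrow>
     (let T = (\<lambda>j. breakpoints xL xU x v ! j);
          nh = length (breakpoints xL xU x v) - 1;
          d = proj_step xL xU x v;
          N = extend_inf (lp_norm tr);
          U = (\<lambda>t. extend_inf (Upsilon Z) (d t))
      in if nh = 0 then \<tau> = 0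
         else if N (d (T nh)) \<le> ereal \<Delta> then is_arg_max U (\<lambda>t. t \<in> T ` {1..nh}) \<tau>
         else (\<exists>jh\<in>{1..nh}. \<exists>\<tau>h\<in>{T (jh - 1)..T jh}.
                 N (d (T (jh - 1))) \<le> ereal \<Delta> \<and> ereal \<Delta> \<le> N (d (T jh)) \<and>
                 N (d \<tau>h) = ereal \<Delta> \<and>
                 is_arg_max U (\<lambda>t. t \<in> T ` {1..jh - 1} \<union> {\<tau>h}) \<tau>))"

definition improve :: "(real ^ 'n) list \<Rightarrow> ereal ^ 'n \<Rightarrow> ereal ^ 'n \<Rightarrow> ereal ^ 'n" where
  "improve Z d e = (if extend_inf (Upsilon Z) e > extend_inf (Upsilon Z) d then e else d)"

text \<open>
  The list argument holds the columns still to be visited; \<open>d\<close> is the value of the program variable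
  before and \<open>d'\<close> its value after these iterations.
\<close>
primrec add_loop ::
  "ereal ^ 'n \<Rightarrow> ereal ^ 'n \<Rightarrow> real ^ 'n \<Rightarrow> real \<Rightarrow> real \<Rightarrow> (real ^ 'n) list \<Rightarrow>
   (real ^ 'n) list \<Rightarrow> ereal ^ 'n \<Rightarrow> ereal ^ 'n \<Rightarrow> bool" where
  "add_loop xL xU x tr \<Delta> Z [] d d' \<longleftrightarrow> d' = d"
| "add_loop xL xU x tr \<Delta> Z (z # zs) d d' \<longleftrightarrow>
     (\<exists>\<tau>p \<tau>m. opt_step xL xU x tr \<Delta> Z z \<tau>p \<and> opt_step xL xU x tr \<Delta> Z (- z) \<tau>m \<and>
        add_loop xL xU x tr \<Delta> Z zs
          (improve Z (improve Z d (proj_step xL xU x z \<tau>p)) (proj_step xL xU x (- z) \<tau>m)) d')"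

text \<open>
  \<open>d\<close> is the final value of the program variable, a priori extended-real valued, and \<open>D'\<close>, \<open>Z'\<close> are the
  updated data. The relation does not require \<open>d\<close> to be finite; \<^const>\<open>real_vec\<close> is only meaningful
  when it is.
\<close>
definition add_direction ::
  "ereal ^ 'n \<Rightarrow> ereal ^ 'n \<Rightarrow> real ^ 'n \<Rightarrow> real \<Rightarrow> real \<Rightarrow> (real ^ 'n) set \<Rightarrow> (real ^ 'n) list \<Rightarrow>
   ereal ^ 'n \<Rightarrow> (real ^ 'n) set \<Rightarrow> (real ^ 'n) list \<Rightarrow> bool" where
  "add_direction xL xU x tr \<Delta> D Z d D' Z' \<longleftrightarrow>
     add_loop xL xU x tr \<Delta> Z Z 0 d \<and> D' = insert (real_vec d) D \<and> orthonormal_complement D' Z'"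

end

theory Submission
  imports Defs
begin

text \<open>
  The bound already holds after the first column \<open>z\<close> of \<open>Z\<close>, and later columns can only increase
  \<open>\<Upsilon>\<close>. As \<open>z\<close> is a unit vector, some \<open>j\<close> has \<open>z\<^sub>j\<^sup>2 \<ge> 1 / n\<close>; choose \<open>v = \<plusminus>z\<close> so that coordinate \<open>j\<close> moves
  towards the farther of its two bounds, at distance at least half the width of the box. All
  \<open>v\<^sub>i d\<^sub>i\<close> are nonnegative for \<open>d = d(v, \<sigma>)\<close>, hence \<open>v \<bullet> d \<ge> v\<^sub>j d\<^sub>j\<close>. Let \<open>\<sigma>\<close> be the largest
  candidate of \<open>OptStep\<close>. If coordinate \<open>j\<close> has reached its bound, then \<open>|d\<^sub>j|\<close> is at least half the
  width. Otherwise \<open>d\<close> has \<open>\<ell>\<^sub>t\<^sub>r\<close>-norm \<open>\<Delta>\<close> and \<open>|d\<^sub>i| \<le> \<sigma> |v\<^sub>i|\<close> for all \<open>i\<close>, so \<open>\<Delta> / \<kappa> \<le> \<parallel>d\<parallel>\<^sub>2 \<le> \<sigma>\<close> and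
  \<open>v\<^sub>j d\<^sub>j = \<sigma> v\<^sub>j\<^sup>2 \<ge> \<Delta> / (n \<kappa>)\<close>.
\<close>

section \<open>Monotonicity and continuity of the \<open>lp_norm\<close>\<close>

lemma lp_norm_mono:
  assumes "0 < p" "\<And>j. \<bar>v $ j\<bar> \<le> \<bar>w $ j\<bar>"
  shows "lp_norm p v \<le> lp_norm p w"
  unfolding lp_norm_def using assms
  by (intro powr_mono2 sum_mono sum_nonneg) auto

lemma abs_component_le_lp_norm:
  assumes "0 < p"
  shows "\<bar>v $ j\<bar> \<le> lp_norm p v"
proof -
  have "\<bar>v $ j\<bar> powr p \<le> (\<Sum>i\<in>UNIV. \<bar>v $ i\<bar> powr p)"
    by (rule member_le_sum) auto
  then have "(\<bar>v $ j\<bar> powr p) powr (1 / p) \<le> lp_norm p v"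
    unfolding lp_norm_def using assms by (intro powr_mono2) auto
  then show ?thesis
    using assms by (simp add: powr_powr)
qed

lemma lp_norm_zero [simp]: "lp_norm p 0 = 0"
  by (simp add: lp_norm_def)

lemma continuous_on_lp_norm:
  assumes "0 < p" "\<And>j. continuous_on S (\<lambda>t. f t $ j)"
  shows "continuous_on S (\<lambda>t. lp_norm p (f t))"
  unfolding lp_norm_def using assms
  by (intro continuous_on_powr' continuous_on_sum continuous_on_rabs continuous_on_const
      ballI conjI impI sum_nonneg) auto

section \<open>Extended vectors with finite components\<close>

lemma real_vec_ereal_vec [simp]: "real_vec (ereal_vec a) = a"
  by (simp add: real_vec_def ereal_vec_def vec_eq_iff)

lemma ereal_vec_nth [simp]: "ereal_vec a $ j = ereal (a $ j)"
  by (simp add: ereal_vec_def)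

lemma ereal_vec_zero: "ereal_vec 0 = 0"
  by (simp add: vec_eq_iff zero_ereal_def)

lemma extend_inf_ereal_vec [simp]: "extend_inf f (ereal_vec a) = ereal (f a)"
  by (simp add: extend_inf_def)

lemma ereal_vec_real_vec: "\<forall>j. \<bar>d $ j\<bar> \<noteq> \<infinity> \<Longrightarrow> d = ereal_vec (real_vec d)"
  by (simp add: vec_eq_iff real_vec_def ereal_real)

text \<open>An infinite component would give the value \<infinity>. Any finite bound therefore
  certifies that the vector is real; this is how finiteness of the steps is obtained later
  on.\<close>

lemma extend_inf_le_erealE:
  assumes "extend_inf f d \<le> ereal c"
  obtains a where "d = ereal_vec a" "f a \<le> c"
proof -
  have "\<forall>j. \<bar>d $ j\<bar> \<noteq> \<infinity>"
    using assms by (auto simp: extend_inf_def split: if_splits)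
  then have "d = ereal_vec (real_vec d)" "f (real_vec d) \<le> c"
    using assms by (auto simp: ereal_vec_real_vec extend_inf_def)
  with that show ?thesis by blast
qed

lemma extend_inf_lp_norm_mono:
  assumes "0 < p" "\<And>j. \<bar>d $ j\<bar> \<le> \<bar>e $ j\<bar>"
  shows "extend_inf (lp_norm p) d \<le> extend_inf (lp_norm p) e"
proof (cases "\<forall>j. \<bar>e $ j\<bar> \<noteq> \<infinity>")
  case True
  have "\<forall>j. \<bar>d $ j\<bar> \<noteq> \<infinity>"
  proof
    fix j
    show "\<bar>d $ j\<bar> \<noteq> \<infinity>" using True[rule_format, of j] assms(2)[of j] by auto
  qed
  with True obtain a b where ab: "d = ereal_vec a" "e = ereal_vec b"
    using ereal_vec_real_vec by blast
  then show ?thesis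
    using assms by (auto intro: lp_norm_mono)
next
  case False
  then have "extend_inf (lp_norm p) e = \<infinity>"
    unfolding extend_inf_def by (rule if_not_P)
  then show ?thesis by simp
qed

section \<open>The projected step: monotonicity and feasibility\<close>

lemma tau_bar_nonneg:
  assumes "x \<in> box_domain xL xU"
  shows "0 \<le> tau_bar xL xU x v j"
proof -
  have "xL $ j \<le> ereal (x $ j)" "ereal (x $ j) \<le> xU $ j"
    using assms by (auto simp: box_domain_def)
  then show ?thesis
    by (cases "xL $ j"; cases "xU $ j")
       (auto simp: tau_bar_def divide_simps)
qed

lemma abs_proj_step:
  assumes "x \<in> box_domain xL xU" "0 \<le> \<tau>"
  shows "\<bar>proj_step xL xU x v \<tau> $ j\<bar> = min \<tau> (tau_bar xL xU x v j) * ereal \<bar>v $ j\<bar>"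
proof -
  have "0 \<le> min \<tau> (tau_bar xL xU x v j)"
    using assms tau_bar_nonneg[OF assms(1)] by simp
  then show ?thesis
    unfolding proj_step_def
    by (cases "min \<tau> (tau_bar xL xU x v j)") (auto simp: abs_mult)
qed

lemma lp_norm_proj_step_mono:
  assumes "x \<in> box_domain xL xU" "0 < p" "0 \<le> \<sigma>" "\<sigma> \<le> \<tau>"
  shows "extend_inf (lp_norm p) (proj_step xL xU x v \<sigma>)
    \<le> extend_inf (lp_norm p) (proj_step xL xU x v \<tau>)"
proof (rule extend_inf_lp_norm_mono[OF assms(2)])
  fix j
  show "\<bar>proj_step xL xU x v \<sigma> $ j\<bar> \<le> \<bar>proj_step xL xU x v \<tau> $ j\<bar>"
    using assms by (simp add: abs_proj_step) (intro ereal_mult_right_mono min.mono, auto)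
qed

lemma proj_step_zero [simp]:
  assumes "x \<in> box_domain xL xU"
  shows "proj_step xL xU x v 0 = 0"
  using tau_bar_nonneg[OF assms] by (simp add: proj_step_def vec_eq_iff min_absorb1)

text \<open>The factor of coordinate \<open>j\<close> never exceeds \<open>tau_bar\<close>, so the
  bound in the direction of motion is not crossed, while motion away from the opposite bound is
  harmless. Finiteness of the step rules out an infinite factor when \<open>v $ j\<close> is
  nonzero.\<close>

lemma proj_step_feasible:
  assumes x: "x \<in> box_domain xL xU" and "0 \<le> \<tau>"
    and a: "proj_step xL xU x v \<tau> = ereal_vec a"
  shows "x + a \<in> box_domain xL xU"
proof -
  have "xL $ j \<le> ereal (x $ j + a $ j) \<and> ereal (x $ j + a $ j) \<le> xU $ j" for j
  proof -
    define t where "t = min \<tau> (tau_bar xL xU x v j)"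
    have t: "0 \<le> t" "t \<le> tau_bar xL xU x v j"
      using assms tau_bar_nonneg[OF x] by (auto simp: t_def)
    have "proj_step xL xU x v \<tau> $ j = ereal (a $ j)"
      using a by simp
    then have e: "t * ereal (v $ j) = ereal (a $ j)"
      by (simp add: proj_step_def t_def)
    have b: "xL $ j \<le> ereal (x $ j)" "ereal (x $ j) \<le> xU $ j"
      using x by (auto simp: box_domain_def)
    consider "v $ j = 0" | "v $ j > 0" | "v $ j < 0" by linarith
    then show ?thesis
    proof cases
      case 1
      with e have "a $ j = 0" by (simp add: zero_ereal_def[symmetric])
      with b show ?thesis by simp
    next
      case 2
      with e t obtain s where s: "t = ereal s" "0 \<le> s" "a $ j = s * v $ j"
        by (cases t) auto
      show ?thesis
        using b t 2 s
        by (cases "xL $ j"; cases "xU $ j") (auto simp: tau_bar_def field_simps intro!: add_increasing2)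
    next
      case 3
      with e t obtain s where s: "t = ereal s" "0 \<le> s" "a $ j = s * v $ j"
        by (cases t) auto
      have "s * v $ j \<le> 0" using 3 s by (simp add: mult_nonneg_nonpos)
      then show ?thesis
        using b t 3 s
        by (cases "xL $ j"; cases "xU $ j") (auto simp: tau_bar_def field_simps)
    qed
  qed
  then show ?thesis by (simp add: box_domain_def)
qed

section \<open>Steps of prescribed norm\<close>

text \<open>For a real step length every factor is finite, so \<open>real_of_ereal\<close> loses
  nothing. This provides the real function to which the intermediate value theorem applies.\<close>

lemma proj_step_real:
  assumes "x \<in> box_domain xL xU" "0 \<le> t"
  shows "proj_step xL xU x v (ereal t)
    = ereal_vec (\<chi> j. real_of_ereal (min (ereal t) (tau_bar xL xU x v j)) * v $ j)"
proof -
  have "min (ereal t) (tau_bar xL xU x v j) * ereal (v $ j)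
    = ereal (real_of_ereal (min (ereal t) (tau_bar xL xU x v j)) * v $ j)" for j
    using tau_bar_nonneg[OF assms(1), of v j] assms(2)
    by (cases "tau_bar xL xU x v j") (auto simp: min_def)
  then show ?thesis
    by (simp add: proj_step_def vec_eq_iff)
qed

lemma continuous_on_min_ereal:
  assumes "0 \<le> b"
  shows "continuous_on S (\<lambda>t. real_of_ereal (min (ereal t) b))"
proof (cases b)
  case (real r)
  have "(\<lambda>t. real_of_ereal (min (ereal t) b)) = (\<lambda>t. min t r)"
    by (auto simp: real min_def)
  then show ?thesis
    by (simp only:) (intro continuous_intros)
next
  case PInf
  then show ?thesis by (simp add: continuous_on_id)
qed (use assms in auto)

text \<open>The last breakpoint may be infinite, whereas the intermediate value theorem needs a real
  right end. Either some coordinate moves forever and alone makes the norm large, or the step is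
  constant beyond the last finite breakpoint.\<close>

lemma ex_real_step_beyond:
  assumes x: "x \<in> box_domain xL xU" and p: "0 < p" and "0 \<le> \<alpha>"
    and "ereal \<Delta> \<le> extend_inf (lp_norm p) (proj_step xL xU x v \<infinity>)"
  obtains \<beta> where "\<alpha> \<le> \<beta>" "ereal \<Delta> \<le> extend_inf (lp_norm p) (proj_step xL xU x v (ereal \<beta>))"
proof (cases "\<exists>j. v $ j \<noteq> 0 \<and> tau_bar xL xU x v j = \<infinity>")
  case True
  then obtain j where j: "v $ j \<noteq> 0" "tau_bar xL xU x v j = \<infinity>" by blast
  \<comment> \<open>Coordinate \<open>j\<close> is never blocked, so its displacement is \<beta>
    times \<open>v $ j\<close>, of absolute value at least \<Delta>.\<close>
  define \<beta> where "\<beta> = max \<alpha> (\<Delta> / \<bar>v $ j\<bar>)"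
  have \<beta>: "0 \<le> \<beta>" "\<Delta> / \<bar>v $ j\<bar> \<le> \<beta>" "\<alpha> \<le> \<beta>"
    using assms by (auto simp: \<beta>_def)
  then have "\<Delta> \<le> \<beta> * \<bar>v $ j\<bar>"
    using j by (simp add: divide_simps split: if_splits)
  also have "\<dots> \<le> lp_norm p (\<chi> j. real_of_ereal (min (ereal \<beta>) (tau_bar xL xU x v j)) * v $ j)"
    using abs_component_le_lp_norm[OF p,
        of "\<chi> j. real_of_ereal (min (ereal \<beta>) (tau_bar xL xU x v j)) * v $ j" j] j \<beta>
    by (simp add: abs_mult)
  finally show ?thesis
    using that[of \<beta>] \<beta> by (simp add: proj_step_real[OF x])
next
  case False
  \<comment> \<open>\<open>real_of_ereal\<close> turns infinite breakpoints into 0. This is harmless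
    here: they occur only where \<open>v $ j = 0\<close>, and such coordinates do not move.\<close>
  define \<beta> where "\<beta> = max \<alpha> (Max (range (\<lambda>j. real_of_ereal (tau_bar xL xU x v j))))"
  have "min (ereal \<beta>) (tau_bar xL xU x v j) * ereal (v $ j)
    = min \<infinity> (tau_bar xL xU x v j) * ereal (v $ j)" for j
  proof (cases "v $ j = 0")
    case False
    with \<open>\<not> (\<exists>j. v $ j \<noteq> 0 \<and> tau_bar xL xU x v j = \<infinity>)\<close> tau_bar_nonneg[OF x, of v j]
    obtain r where r: "tau_bar xL xU x v j = ereal r"
      by (cases "tau_bar xL xU x v j") auto
    have "real_of_ereal (tau_bar xL xU x v j) \<le> \<beta>"
      unfolding \<beta>_def by (rule max.coboundedI2) simp
    with r show ?thesis by (simp add: min_absorb2)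
  qed (simp add: zero_ereal_def[symmetric])
  then have "proj_step xL xU x v (ereal \<beta>) = proj_step xL xU x v \<infinity>"
    by (simp add: proj_step_def)
  with that[of \<beta>] assms show ?thesis
    by (simp add: \<beta>_def)
qed

lemma ex_step_of_lp_norm:
  assumes x: "x \<in> box_domain xL xU" and p: "0 < p" and a: "0 \<le> a" "a \<le> b"
    and na: "extend_inf (lp_norm p) (proj_step xL xU x v a) \<le> ereal \<Delta>"
    and nb: "ereal \<Delta> \<le> extend_inf (lp_norm p) (proj_step xL xU x v b)"
  shows "\<exists>\<tau>\<in>{a..b}. extend_inf (lp_norm p) (proj_step xL xU x v \<tau>) = ereal \<Delta>"
proof (cases a)
  case (real \<alpha>)
  then have \<alpha>: "0 \<le> \<alpha>" using a by simp
  obtain \<beta> where \<beta>: "\<alpha> \<le> \<beta>" "ereal \<beta> \<le> b"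
    "ereal \<Delta> \<le> extend_inf (lp_norm p) (proj_step xL xU x v (ereal \<beta>))"
  proof (cases b)
    case (real r)
    with that[of r] a nb \<open>a = ereal \<alpha>\<close> show ?thesis by auto
  next
    case PInf
    with ex_real_step_beyond[OF x p \<alpha>, of \<Delta> v] nb that show ?thesis by auto
  qed (use a in auto)
  define g where "g t = (\<chi> j. real_of_ereal (min (ereal t) (tau_bar xL xU x v j)) * v $ j)" for t
  have g: "proj_step xL xU x v (ereal t) = ereal_vec (g t)" if "0 \<le> t" for t
    using proj_step_real[OF x that] by (simp add: g_def)
  have "continuous_on {\<alpha>..\<beta>} (\<lambda>t. lp_norm p (g t))"
    unfolding g_def using tau_bar_nonneg[OF x]
    by (intro continuous_on_lp_norm[OF p])
       (simp, intro continuous_on_mult_right continuous_on_min_ereal, simp)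
  moreover have "lp_norm p (g \<alpha>) \<le> \<Delta>" "\<Delta> \<le> lp_norm p (g \<beta>)"
    using na \<beta> \<alpha> real g by auto
  ultimately obtain t where "\<alpha> \<le> t" "t \<le> \<beta>" "lp_norm p (g t) = \<Delta>"
    using IVT'[of "\<lambda>t. lp_norm p (g t)" \<alpha> \<Delta> \<beta>] \<beta> by auto
  moreover from this have "ereal t \<le> b"
    using order_trans[of "ereal t" "ereal \<beta>" b] \<beta>(2) by simp
  ultimately show ?thesis
    using real \<alpha> g by (intro bexI[of _ "ereal t"]) auto
next
  \<comment> \<open>Now \<open>a\<close> and \<open>b\<close> are both infinite, and the two bounds
    on the norm give equality.\<close>
  case PInf
  with a na nb show ?thesis by auto
qed (use a in auto)

section \<open>Runs of \<open>opt_step\<close>: existence and the largest candidate\<close>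

lemma ex_is_arg_max_if_finite:
  fixes f :: "'a \<Rightarrow> 'b :: linorder"
  assumes "finite S" "S \<noteq> {}"
  shows "\<exists>s. is_arg_max f (\<lambda>s. s \<in> S) s"
proof -
  have "Max (f ` S) \<in> f ` S" using assms by simp
  then obtain s where "s \<in> S" "f s = Max (f ` S)" by auto
  then show ?thesis using assms by (auto simp: is_arg_max_linorder)
qed

lemma breakpoints_nth_0 [simp]: "breakpoints xL xU x v ! 0 = 0"
  by (simp add: breakpoints_def)

lemma sorted_breakpoints: "sorted (breakpoints xL xU x v)"
  by (auto simp: breakpoints_def intro: order_less_imp_le)

lemma breakpoints_mono:
  assumes "i \<le> j" "j \<le> length (breakpoints xL xU x v) - 1"
  shows "breakpoints xL xU x v ! i \<le> breakpoints xL xU x v ! j"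
  using sorted_breakpoints by (rule sorted_nth_mono) (use assms in \<open>auto simp: breakpoints_def\<close>)

text \<open>Each value is positive and hence listed, or it is 0 and equals the head. The list is
  sorted, so its last entry dominates, even when the head is its only entry.\<close>

lemma tau_bar_le_last_breakpoint:
  assumes "x \<in> box_domain xL xU"
  shows "tau_bar xL xU x v j \<le> breakpoints xL xU x v ! (length (breakpoints xL xU x v) - 1)"
proof -
  have "tau_bar xL xU x v j \<in> set (breakpoints xL xU x v)"
    using tau_bar_nonneg[OF assms, of v j] by (auto simp: breakpoints_def)
  then obtain i where "i < length (breakpoints xL xU x v)"
    "breakpoints xL xU x v ! i = tau_bar xL xU x v j"
    by (auto simp: in_set_conv_nth)
  then show ?thesis
    using breakpoints_mono[of i "length (breakpoints xL xU x v) - 1"] by fastforce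
qed

text \<open>Maximizers over finite nonempty sets always exist. What needs an argument is a
  bracketing index and a step of norm exactly \<Delta> when the last breakpoint is too far.\<close>

lemma ex_opt_step:
  assumes x: "x \<in> box_domain xL xU" and p: "0 < p" and \<Delta>: "0 \<le> \<Delta>"
  shows "\<exists>\<tau>. opt_step xL xU x p \<Delta> Z v \<tau>"
proof -
  define T where "T = (\<lambda>j. breakpoints xL xU x v ! j)"
  define nh where "nh = length (breakpoints xL xU x v) - 1"
  define N where "N t = extend_inf (lp_norm p) (proj_step xL xU x v t)" for t
  define U where "U t = extend_inf (Upsilon Z) (proj_step xL xU x v t)" for t
  have T0: "T 0 = 0" by (simp add: T_def)
  have Tmono: "T i \<le> T j" if "i \<le> j" "j \<le> nh" for i j
    using breakpoints_mono that by (auto simp: T_def nh_def)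
  have opt: "opt_step xL xU x p \<Delta> Z v \<tau> \<longleftrightarrow>
     (if nh = 0 then \<tau> = 0
      else if N (T nh) \<le> ereal \<Delta> then is_arg_max U (\<lambda>t. t \<in> T ` {1..nh}) \<tau>
      else (\<exists>jh\<in>{1..nh}. \<exists>\<tau>h\<in>{T (jh - 1)..T jh}.
              N (T (jh - 1)) \<le> ereal \<Delta> \<and> ereal \<Delta> \<le> N (T jh) \<and> N \<tau>h = ereal \<Delta> \<and>
              is_arg_max U (\<lambda>t. t \<in> T ` {1..jh - 1} \<union> {\<tau>h}) \<tau>))" for \<tau>
    unfolding opt_step_def Let_def T_def nh_def N_def U_def by simp
  consider "nh = 0" | "nh \<noteq> 0" "N (T nh) \<le> ereal \<Delta>" | "nh \<noteq> 0" "ereal \<Delta> < N (T nh)"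
    by fastforce
  then show ?thesis
  proof cases
    case 2
    then show ?thesis
      using ex_is_arg_max_if_finite[of "T ` {1..nh}" U] by (auto simp: opt)
  next
    case 3
    \<comment> \<open>The first breakpoint beyond the radius: by minimality its predecessor
      satisfies the other half of the bracketing condition.\<close>
    define jh where "jh = (LEAST i. ereal \<Delta> < N (T i))"
    have jh: "ereal \<Delta> < N (T jh)" "jh \<le> nh"
      unfolding jh_def using 3(2) by (rule LeastI, rule Least_le)
    have "N (T 0) \<le> ereal \<Delta>"
      using \<Delta> x by (simp add: T0 N_def flip: ereal_vec_zero)
    \<comment> \<open>The step at index 0 is zero, hence within the radius. So \<open>jh - 1\<close>
      is a true predecessor and not a truncated subtraction.\<close>
    with jh(1) have "jh \<noteq> 0" by (metis not_less)
    then have below: "N (T (jh - 1)) \<le> ereal \<Delta>"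
      using not_less_Least[of "jh - 1" "\<lambda>i. ereal \<Delta> < N (T i)"] by (simp add: jh_def not_less)
    have "0 \<le> T (jh - 1)" "T (jh - 1) \<le> T jh"
      using Tmono[of 0 "jh - 1"] Tmono[of "jh - 1" jh] jh(2) T0 by auto
    then obtain \<tau>h where \<tau>h: "\<tau>h \<in> {T (jh - 1)..T jh}" "N \<tau>h = ereal \<Delta>"
      using ex_step_of_lp_norm[OF x p, of "T (jh - 1)" "T jh" v \<Delta>] below jh(1)
      unfolding N_def by (meson order_less_imp_le)
    obtain \<tau> where "is_arg_max U (\<lambda>t. t \<in> T ` {1..jh - 1} \<union> {\<tau>h}) \<tau>"
      using ex_is_arg_max_if_finite[of "T ` {1..jh - 1} \<union> {\<tau>h}" U] by auto
    then have "opt_step xL xU x p \<Delta> Z v \<tau>"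
      unfolding opt using 3 jh \<tau>h below \<open>jh \<noteq> 0\<close>
      by (auto simp: not_le intro!: bexI[of _ jh] bexI[of _ \<tau>h])
    then show ?thesis ..
  qed (auto simp: opt)
qed

text \<open>The witness \<sigma> is the largest candidate: 0, the last breakpoint or the point of
  norm \<Delta>, according to the branch taken. The final disjunction records why the search ended
  there: every coordinate is blocked or the radius is reached. The maximizer \<tau> does at least as
  well as \<sigma>.\<close>

lemma opt_step_candidate:
  assumes x: "x \<in> box_domain xL xU" and p: "0 < p" and \<Delta>: "0 \<le> \<Delta>"
    and "opt_step xL xU x p \<Delta> Z v \<tau>"
  obtains \<sigma> where "0 \<le> \<tau>" "extend_inf (lp_norm p) (proj_step xL xU x v \<tau>) \<le> ereal \<Delta>"
    "0 \<le> \<sigma>" "extend_inf (lp_norm p) (proj_step xL xU x v \<sigma>) \<le> ereal \<Delta>"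
    "extend_inf (Upsilon Z) (proj_step xL xU x v \<sigma>)
      \<le> extend_inf (Upsilon Z) (proj_step xL xU x v \<tau>)"
    "(\<forall>j. tau_bar xL xU x v j \<le> \<sigma>) \<or>
      extend_inf (lp_norm p) (proj_step xL xU x v \<sigma>) = ereal \<Delta>"
proof -
  note result = that
  define T where "T = (\<lambda>j. breakpoints xL xU x v ! j)"
  define nh where "nh = length (breakpoints xL xU x v) - 1"
  define N where "N t = extend_inf (lp_norm p) (proj_step xL xU x v t)" for t
  define U where "U t = extend_inf (Upsilon Z) (proj_step xL xU x v t)" for t
  have T0: "T 0 = 0" by (simp add: T_def)
  have Tmono: "T i \<le> T j" if "i \<le> j" "j \<le> nh" for i j
    using breakpoints_mono that by (auto simp: T_def nh_def)
  have Tnonneg: "0 \<le> T i" if "i \<le> nh" for i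
    using Tmono[of 0 i] that T0 by simp
  have Tlast: "tau_bar xL xU x v j \<le> T nh" for j
    using tau_bar_le_last_breakpoint[OF x] by (simp add: T_def nh_def)
  have Nmono: "N s \<le> N t" if "0 \<le> s" "s \<le> t" for s t
    unfolding N_def using lp_norm_proj_step_mono[OF x p that] .
  have opt: "if nh = 0 then \<tau> = 0
      else if N (T nh) \<le> ereal \<Delta> then is_arg_max U (\<lambda>t. t \<in> T ` {1..nh}) \<tau>
      else (\<exists>jh\<in>{1..nh}. \<exists>\<tau>h\<in>{T (jh - 1)..T jh}.
              N (T (jh - 1)) \<le> ereal \<Delta> \<and> ereal \<Delta> \<le> N (T jh) \<and> N \<tau>h = ereal \<Delta> \<and>
              is_arg_max U (\<lambda>t. t \<in> T ` {1..jh - 1} \<union> {\<tau>h}) \<tau>)"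
    using assms(4) unfolding opt_step_def Let_def T_def nh_def N_def U_def by simp
  have *: thesis if "0 \<le> \<tau>" "N \<tau> \<le> ereal \<Delta>" "0 \<le> \<sigma>" "N \<sigma> \<le> ereal \<Delta>" "U \<sigma> \<le> U \<tau>"
    "(\<forall>j. tau_bar xL xU x v j \<le> \<sigma>) \<or> N \<sigma> = ereal \<Delta>" for \<sigma>
    using result[of \<sigma>] that by (simp add: N_def U_def)
  consider "nh = 0" "\<tau> = 0"
    | "N (T nh) \<le> ereal \<Delta>" "nh \<noteq> 0" "is_arg_max U (\<lambda>t. t \<in> T ` {1..nh}) \<tau>"
    | jh \<tau>h where "jh \<in> {1..nh}" "\<tau>h \<in> {T (jh - 1)..T jh}" "N (T (jh - 1)) \<le> ereal \<Delta>"
      "N \<tau>h = ereal \<Delta>" "is_arg_max U (\<lambda>t. t \<in> T ` {1..jh - 1} \<union> {\<tau>h}) \<tau>"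
    using opt by (auto split: if_splits)
  then show thesis
  proof cases
    case 1
    \<comment> \<open>Without positive breakpoints all values of \<open>tau_bar\<close> are 0, so
      \<sigma> = 0 already blocks every coordinate.\<close>
    have "N 0 \<le> ereal \<Delta>"
      using \<Delta> x by (simp add: N_def flip: ereal_vec_zero)
    with 1 Tlast T0 show thesis by (intro *[of 0]) auto
  next
    case 2
    from 2(3) obtain i where i: "i \<in> {1..nh}" "\<tau> = T i"
      by (auto simp: is_arg_max_linorder)
    have "U (T nh) \<le> U \<tau>" using 2 by (auto simp: is_arg_max_linorder)
    moreover have "N \<tau> \<le> ereal \<Delta>"
      using 2(1) i Nmono[of "T i" "T nh"] Tmono[of i nh] Tnonneg[of i] by auto
    ultimately show thesis
      using i Tnonneg Tlast 2(1) by (intro *[of "T nh"]) auto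
  next
    case 3
    have "0 \<le> T (jh - 1)" using 3(1) by (intro Tnonneg) auto
    then have "0 \<le> \<tau>h" using 3(2) by auto
    moreover have "U \<tau>h \<le> U \<tau>" using 3(5) by (auto simp: is_arg_max_linorder)
    moreover have "0 \<le> \<tau> \<and> N \<tau> \<le> ereal \<Delta>"
    proof (cases "\<tau> = \<tau>h")
      \<comment> \<open>The maximizer is then a breakpoint of index at most \<open>jh - 1\<close>,
        and the norm is monotone in the step length.\<close>
      case False
      with 3(5) obtain i where i: "i \<in> {1..jh - 1}" "\<tau> = T i"
        by (auto simp: is_arg_max_linorder)
      then show ?thesis
        using 3(1,3) Nmono[of "T i" "T (jh - 1)"] Tmono[of i "jh - 1"] Tnonneg[of i] by auto
    qed (use 3(4) \<open>0 \<le> \<tau>h\<close> in auto)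
    ultimately show thesis
      using 3(4) by (intro *[of \<tau>h]) auto
  qed
qed

section \<open>Inner product of a direction with its step\<close>

lemma proj_step_component:
  assumes x: "x \<in> box_domain xL xU" and "0 \<le> \<sigma>" and d: "proj_step xL xU x v \<sigma> = ereal_vec s"
    and "v $ j \<noteq> 0"
  obtains t where "min \<sigma> (tau_bar xL xU x v j) = ereal t" "0 \<le> t" "s $ j = t * v $ j"
proof -
  have e: "min \<sigma> (tau_bar xL xU x v j) * ereal (v $ j) = ereal (s $ j)"
    using arg_cong[OF d, of "\<lambda>a. a $ j"] by (simp add: proj_step_def)
  have "0 \<le> min \<sigma> (tau_bar xL xU x v j)"
    using assms tau_bar_nonneg[OF x] by simp
  with e \<open>v $ j \<noteq> 0\<close> that show thesis
    by (cases "min \<sigma> (tau_bar xL xU x v j)") (auto split: if_splits)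
qed

text \<open>Here \<open>m\<close> is a lower bound for the squared component and \<open>c\<close>
  one for the distance to the bound that coordinate \<open>j\<close> approaches. The minimum merges
  two cases: coordinate \<open>j\<close> is blocked and yields \<open>c\<close>, or the radius is
  reached and yields \<Delta> / \<kappa>.\<close>

lemma inner_proj_step_ge:
  assumes x: "x \<in> box_domain xL xU" and v: "norm v = 1"
    and \<sigma>: "0 \<le> \<sigma>" and d: "proj_step xL xU x v \<sigma> = ereal_vec s"
    and stop: "(\<forall>j. tau_bar xL xU x v j \<le> \<sigma>) \<or> lp_norm p s = \<Delta>"
    and \<kappa>: "0 < \<kappa>" "lp_norm p s \<le> \<kappa> * norm s"
    and m: "0 < m" "m \<le> (v $ j)\<^sup>2"
    and room: "0 \<le> c" "ereal c \<le> tau_bar xL xU x v j * ereal \<bar>v $ j\<bar>"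
  shows "m * min c (\<Delta> / \<kappa>) \<le> v \<bullet> s"
proof -
  have nonneg: "0 \<le> v $ i * s $ i" for i
  proof (cases "v $ i = 0")
    case False
    then obtain r where "0 \<le> r" "s $ i = r * v $ i"
      using proj_step_component[OF x \<sigma> d] by blast
    then show ?thesis by (simp add: mult.left_commute)
  qed simp
  have "v $ j * s $ j \<le> (\<Sum>i\<in>UNIV. v $ i * s $ i)"
    by (rule member_le_sum) (auto simp: nonneg)
  then have vs: "v $ j * s $ j \<le> v \<bullet> s"
    by (simp add: inner_vec_def)
  have vj: "v $ j \<noteq> 0" using m by auto
  then obtain t where t: "min \<sigma> (tau_bar xL xU x v j) = ereal t" "0 \<le> t" "s $ j = t * v $ j"
    using proj_step_component[OF x \<sigma> d] by blast
  \<comment> \<open>A blocked coordinate contributes its distance times only the first power of the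
    absolute value of \<open>v $ j\<close>. For a unit vector this power dominates the square, so
    \<open>m\<close> bounds it as well.\<close>
  have "\<bar>v $ j\<bar> \<le> 1"
    using component_le_norm_cart[of v j] v by simp
  then have "\<bar>v $ j\<bar> * \<bar>v $ j\<bar> \<le> \<bar>v $ j\<bar>"
    by (intro mult_left_le) auto
  then have m1: "m \<le> \<bar>v $ j\<bar>"
    using m(2) by (simp add: power2_eq_square)
  show ?thesis
  proof (cases "tau_bar xL xU x v j \<le> \<sigma>")
    case True
    with t room have c: "c \<le> t * \<bar>v $ j\<bar>" by (simp add: min_absorb2)
    have "m * min c (\<Delta> / \<kappa>) \<le> m * c"
      using m by (intro mult_left_mono) auto
    also have "\<dots> \<le> \<bar>v $ j\<bar> * (t * \<bar>v $ j\<bar>)"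
      using m1 c room(1) by (intro mult_mono) auto
    also have "\<dots> = v $ j * s $ j"
      using t by (simp add: algebra_simps flip: power2_eq_square)
    finally show ?thesis using vs by simp
  next
    case False
    \<comment> \<open>Coordinate \<open>j\<close> is not blocked, so the minimum is \<sigma> itself,
      which is therefore finite.\<close>
    with t have \<sigma>t: "\<sigma> = ereal t" by (auto simp: min_def split: if_splits)
    have "\<bar>s $ i\<bar> \<le> t * \<bar>v $ i\<bar>" for i
    proof (cases "v $ i = 0")
      case True
      then have "s $ i = 0"
        using arg_cong[OF d, of "\<lambda>a. a $ i"] by (simp add: proj_step_def flip: zero_ereal_def)
      then show ?thesis using t by simp
    next
      case False
      then obtain r where r: "min \<sigma> (tau_bar xL xU x v i) = ereal r" "0 \<le> r" "s $ i = r * v $ i"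
        using proj_step_component[OF x \<sigma> d] by blast
      then have "r \<le> t"
        using min.cobounded1[of \<sigma> "tau_bar xL xU x v i"] \<sigma>t by simp
      with r show ?thesis by (simp add: abs_mult mult_right_mono)
    qed
    then have "norm s \<le> norm (t *\<^sub>R v)"
      using t(2) by (intro norm_le_componentwise_cart) (simp add: abs_mult)
    then have "norm s \<le> t" using v t by simp
    moreover have "lp_norm p s = \<Delta>" using stop False by auto
    ultimately have "\<Delta> \<le> \<kappa> * t"
      using \<kappa> mult_left_mono[of "norm s" t \<kappa>] by linarith
    then have "\<Delta> / \<kappa> \<le> t"
      using \<kappa> by (simp add: divide_simps mult.commute)
    then have "m * min c (\<Delta> / \<kappa>) \<le> m * t"
      using m by (intro mult_left_mono) auto
    also have "\<dots> \<le> (v $ j)\<^sup>2 * t"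
      using m t by (intro mult_right_mono) auto
    also have "\<dots> = v $ j * s $ j"
      using t by (simp add: power2_eq_square)
    finally show ?thesis using vs by simp
  qed
qed

text \<open>The product is the distance from \<open>x $ j\<close> to the bound ahead, also when that
  bound is infinite. The two distances add up to the width, so one of them is at least
  \<open>c\<close>, and the sign of \<open>v\<close> selects it.\<close>

lemma tau_bar_room:
  assumes x: "x \<in> box_domain xL xU" and "z $ j \<noteq> 0"
    and "ereal (2 * c) \<le> xU $ j - xL $ j"
  shows "\<exists>v\<in>{z, - z}. ereal c \<le> tau_bar xL xU x v j * ereal \<bar>v $ j\<bar>"
proof -
  have b: "xL $ j \<le> ereal (x $ j)" "ereal (x $ j) \<le> xU $ j"
    using x by (auto simp: box_domain_def)
  have up: "tau_bar xL xU x v j * ereal \<bar>v $ j\<bar> = xU $ j - ereal (x $ j)" if "0 < v $ j" for v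
    using b that by (cases "xU $ j") (auto simp: tau_bar_def)
  have low: "tau_bar xL xU x v j * ereal \<bar>v $ j\<bar> = ereal (x $ j) - xL $ j" if "v $ j < 0" for v
    using b that by (cases "xL $ j") (auto simp: tau_bar_def field_simps)
  have "ereal c \<le> xU $ j - ereal (x $ j) \<or> ereal c \<le> ereal (x $ j) - xL $ j"
    using b assms(3) by (cases "xL $ j"; cases "xU $ j") auto
  then show ?thesis
  proof
    assume c: "ereal c \<le> xU $ j - ereal (x $ j)"
    show ?thesis
    proof (cases "0 < z $ j")
      case True
      with up[of z] c show ?thesis by (intro bexI[of _ z]) auto
    next
      case False
      with up[of "- z"] c assms(2) show ?thesis by (intro bexI[of _ "- z"]) auto
    qed
  next
    assume c: "ereal c \<le> ereal (x $ j) - xL $ j"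
    show ?thesis
    proof (cases "z $ j < 0")
      case True
      with low[of z] c show ?thesis by (intro bexI[of _ z]) auto
    next
      case False
      with low[of "- z"] c assms(2) show ?thesis by (intro bexI[of _ "- z"]) auto
    qed
  qed
qed

text \<open>The squared components sum to 1, so they cannot all lie below their average.\<close>

lemma ex_large_component:
  fixes z :: "real ^ 'n"
  assumes "norm z = 1"
  shows "\<exists>j. 1 / real CARD('n) \<le> (z $ j)\<^sup>2"
proof (rule ccontr)
  assume "\<not> ?thesis"
  then have "(\<Sum>j\<in>UNIV. (z $ j)\<^sup>2) < (\<Sum>j\<in>(UNIV :: 'n set). 1 / real CARD('n))"
    by (intro sum_strict_mono) (auto simp: not_le)
  also have "\<dots> = 1" by simp
  finally show False
    using assms by (simp add: norm_vec_def L2_set_def real_sqrt_eq_1_iff)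
qed

section \<open>Growth of \<open>Upsilon\<close> along the loop\<close>

lemma inner_power2_le_Upsilon:
  assumes "z \<in> set Z"
  shows "(z \<bullet> d)\<^sup>2 \<le> Upsilon Z d"
  unfolding Upsilon_def by (rule member_le_sum_list) (use assms in auto)

lemma improve_ge:
  "extend_inf (Upsilon Z) d \<le> extend_inf (Upsilon Z) (improve Z d e)"
  "extend_inf (Upsilon Z) e \<le> extend_inf (Upsilon Z) (improve Z d e)"
  by (auto simp: improve_def)

lemma ex_add_loop:
  assumes "x \<in> box_domain xL xU" "0 < p" "0 \<le> \<Delta>"
  shows "\<exists>d'. add_loop xL xU x p \<Delta> Z zs d d'"
proof (induction zs arbitrary: d)
  case (Cons z zs)
  then show ?case
    using ex_opt_step[OF assms, of Z] by (metis add_loop.simps(2))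
qed (use add_loop.simps(1) in blast)

text \<open>\<open>improve\<close> returns one of its two arguments, so any property shared by the
  start and all results of \<open>opt_step\<close> survives. \<open>P\<close> is left open: it
  becomes feasibility in the theorem and is trivial where only the growth of \<open>Upsilon\<close>
  matters.\<close>

lemma add_loop_invariant:
  assumes "add_loop xL xU x p \<Delta> Z zs d d'" "P d"
    and "\<And>v \<tau>. opt_step xL xU x p \<Delta> Z v \<tau> \<Longrightarrow> P (proj_step xL xU x v \<tau>)"
  shows "P d' \<and> extend_inf (Upsilon Z) d \<le> extend_inf (Upsilon Z) d'"
  using assms(1,2)
proof (induction zs arbitrary: d)
  case (Cons z zs)
  then obtain \<tau>p \<tau>m where \<tau>: "opt_step xL xU x p \<Delta> Z z \<tau>p" "opt_step xL xU x p \<Delta> Z (- z) \<tau>m"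
    and loop: "add_loop xL xU x p \<Delta> Z zs
      (improve Z (improve Z d (proj_step xL xU x z \<tau>p)) (proj_step xL xU x (- z) \<tau>m)) d'"
    by auto
  from \<tau> have "P (improve Z (improve Z d (proj_step xL xU x z \<tau>p)) (proj_step xL xU x (- z) \<tau>m))"
    using assms(3) Cons.prems(2) by (auto simp: improve_def)
  from Cons.IH[OF loop this] show ?case
    using order_trans[OF order_trans[OF improve_ge(1) improve_ge(1)]] by blast
qed simp

section \<open>Orthogonal projection and orthonormal complements\<close>

text \<open>The residual of the sum is orthogonal to every column, hence to the span. Two vectors
  with this property differ by an element of the span that is orthogonal to itself, which gives
  uniqueness.\<close>

lemma orth_proj_eq_sum:
  assumes Z: "orthonormal_columns Z"
  shows "orth_proj Z d = (\<Sum>i<length Z. (Z ! i \<bullet> d) *\<^sub>R Z ! i)" (is "_ = ?p")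
proof -
  have zp: "Z ! k \<bullet> ?p = Z ! k \<bullet> d" if "k < length Z" for k
  proof -
    have "Z ! k \<bullet> ?p = (\<Sum>i<length Z. if i = k then Z ! k \<bullet> d else 0)"
      unfolding inner_sum_right
      using Z that by (intro sum.cong) (auto simp: orthonormal_columns_def)
    with that show ?thesis by simp
  qed
  have p: "?p \<in> span (set Z)"
    by (intro span_sum span_scale span_base) simp
  have orth: "orthogonal (d - ?p) w" if "w \<in> span (set Z)" for w
  proof (rule orthogonal_to_span[OF that])
    fix z assume "z \<in> set Z"
    then obtain k where "k < length Z" "z = Z ! k" unfolding in_set_conv_nth by blast
    with zp[of k] have "z \<bullet> ?p = z \<bullet> d" by blast
    then show "orthogonal (d - ?p) z"
      by (simp only: orthogonal_def inner_commute[of _ z] inner_diff_right)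
  qed
  show ?thesis
    unfolding orth_proj_def
  proof (rule the_equality)
    fix q assume q: "q \<in> span (set Z) \<and> (\<forall>w\<in>span (set Z). orthogonal (d - q) w)"
    then have "?p - q \<in> span (set Z)" using p span_diff by blast
    with q orth have "(d - q) \<bullet> (?p - q) = 0" "(d - ?p) \<bullet> (?p - q) = 0"
      by (auto simp: orthogonal_def)
    then have "(?p - q) \<bullet> (?p - q) = 0" by (simp add: inner_diff_left)
    then show "q = ?p" by simp
  qed (use p orth in auto)
qed

lemma norm_orth_proj:
  assumes Z: "orthonormal_columns Z"
  shows "(norm (orth_proj Z d))\<^sup>2 = Upsilon Z d"
proof -
  have "orth_proj Z d \<bullet> orth_proj Z d
    = (\<Sum>i<length Z. \<Sum>k<length Z. if k = i then (Z ! i \<bullet> d)\<^sup>2 else 0)"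
    unfolding orth_proj_eq_sum[OF Z] inner_sum_left inner_sum_right
    using Z by (intro sum.cong) (auto simp: orthonormal_columns_def power2_eq_square)
  also have "\<dots> = Upsilon Z d"
    by (simp add: Upsilon_def sum_list_sum_nth atLeast0LessThan)
  finally show ?thesis by (simp add: power2_norm_eq_inner)
qed

text \<open>Ensures that the recomputation of \<open>Z\<close> at the end of a call can always be
  carried out.\<close>

lemma ex_orthonormal_complement: "\<exists>Z. orthonormal_complement D Z"
proof -
  obtain B where B: "pairwise orthogonal B" "\<And>b. b \<in> B \<Longrightarrow> norm b = 1" "independent B"
    "span B = orthogonal_comp (span D)"
    using orthonormal_basis_subspace[OF subspace_orthogonal_comp[of "span D"]] by metis
  then obtain Z where Z: "set Z = B" "distinct Z"
    using finite_distinct_list[OF independent_imp_finite[OF B(3)]] by blast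
  have "orthonormal_columns Z"
    unfolding orthonormal_columns_def
  proof (intro allI impI)
    fix i j assume ij: "i < length Z" "j < length Z"
    have B': "Z ! i \<in> B" "Z ! j \<in> B" using nth_mem[OF ij(1)] nth_mem[OF ij(2)] Z(1) by simp_all
    show "Z ! i \<bullet> Z ! j = (if i = j then 1 else 0)"
    proof (cases "i = j")
      case True
      then show ?thesis using B(2)[OF B'(1)] by (simp add: norm_eq_1)
    next
      case False
      then have "Z ! i \<noteq> Z ! j"
        using Z(2) ij by (simp add: nth_eq_iff_index_eq)
      with B(1) B' have "orthogonal (Z ! i) (Z ! j)" by (simp add: pairwise_def)
      with False show ?thesis by (simp add: orthogonal_def)
    qed
  qed
  with B(4) Z(1) have "orthonormal_complement D Z" by (simp add: orthonormal_complement_def)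
  then show ?thesis ..
qed

section \<open>The bound for a whole call\<close>

lemma opt_step_result:
  assumes "x \<in> box_domain xL xU" "0 < p" "0 \<le> \<Delta>" "opt_step xL xU x p \<Delta> Z v \<tau>"
  shows "\<exists>a. proj_step xL xU x v \<tau> = ereal_vec a \<and> lp_norm p a \<le> \<Delta> \<and>
    x + a \<in> box_domain xL xU"
proof -
  have "0 \<le> \<tau>" "extend_inf (lp_norm p) (proj_step xL xU x v \<tau>) \<le> ereal \<Delta>"
    using opt_step_candidate[OF assms] by blast+
  then show ?thesis
    using proj_step_feasible[OF assms(1)] by (auto elim!: extend_inf_le_erealE)
qed

text \<open>The inner product bound holds at the largest candidate, and the maximizer is no worse. A
  single column already contributes the square of that inner product, in which the sign of
  \<open>v\<close> disappears.\<close>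

lemma Upsilon_opt_step_ge:
  fixes x :: "real ^ 'n"
  assumes x: "x \<in> box_domain xL xU" and p: "0 < p" and \<Delta>: "0 \<le> \<Delta>"
    and opt: "opt_step xL xU x p \<Delta> Z v \<tau>"
    and v: "norm v = 1" "v \<in> set Z \<or> - v \<in> set Z"
    and \<kappa>: "0 < \<kappa>" "\<And>s :: real ^ 'n. lp_norm p s \<le> \<kappa> * norm s"
    and m: "0 < m" "m \<le> (v $ j)\<^sup>2"
    and room: "0 \<le> c" "ereal c \<le> tau_bar xL xU x v j * ereal \<bar>v $ j\<bar>"
  shows "ereal ((m * min c (\<Delta> / \<kappa>))\<^sup>2) \<le> extend_inf (Upsilon Z) (proj_step xL xU x v \<tau>)"
proof -
  obtain \<sigma> where \<sigma>: "0 \<le> \<sigma>" "extend_inf (lp_norm p) (proj_step xL xU x v \<sigma>) \<le> ereal \<Delta>"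
    "extend_inf (Upsilon Z) (proj_step xL xU x v \<sigma>)
      \<le> extend_inf (Upsilon Z) (proj_step xL xU x v \<tau>)"
    "(\<forall>j. tau_bar xL xU x v j \<le> \<sigma>) \<or>
      extend_inf (lp_norm p) (proj_step xL xU x v \<sigma>) = ereal \<Delta>"
    by (rule opt_step_candidate[OF x p \<Delta> opt])
  obtain s where s: "proj_step xL xU x v \<sigma> = ereal_vec s"
    using \<sigma>(2) by (rule extend_inf_le_erealE)
  have "m * min c (\<Delta> / \<kappa>) \<le> v \<bullet> s"
    using \<sigma>(4) by (intro inner_proj_step_ge[OF x v(1) \<sigma>(1) s _ \<kappa> m room]) (simp add: s)
  moreover have "0 \<le> m * min c (\<Delta> / \<kappa>)"
    using m room \<Delta> \<kappa> by simp
  ultimately have "(m * min c (\<Delta> / \<kappa>))\<^sup>2 \<le> (v \<bullet> s)\<^sup>2"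
    by (rule power_mono)
  also have "\<dots> \<le> Upsilon Z s"
    using v(2) inner_power2_le_Upsilon[of v Z s] inner_power2_le_Upsilon[of "- v" Z s] by auto
  finally have "ereal ((m * min c (\<Delta> / \<kappa>))\<^sup>2)
      \<le> extend_inf (Upsilon Z) (proj_step xL xU x v \<sigma>)"
    by (simp add: s)
  then show ?thesis using \<sigma>(3) by (rule order_trans)
qed

lemma add_loop_Upsilon_ge:
  fixes x :: "real ^ 'n"
  assumes x: "x \<in> box_domain xL xU" and p: "0 < p" and \<Delta>: "0 \<le> \<Delta>"
    and \<kappa>: "0 < \<kappa>" "\<And>s :: real ^ 'n. lp_norm p s \<le> \<kappa> * norm s"
    and Z: "orthonormal_columns Z" "Z \<noteq> []"
    and c: "0 \<le> c" "\<And>j. ereal (2 * c) \<le> xU $ j - xL $ j"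
    and loop: "add_loop xL xU x p \<Delta> Z Z d d'"
  shows "ereal ((1 / CARD('n) * min c (\<Delta> / \<kappa>))\<^sup>2) \<le> extend_inf (Upsilon Z) d'"
proof -
  obtain z zs where zs: "Z = z # zs" using Z(2) by (cases Z) auto
  have z1: "norm z = 1"
    using Z(1) by (force simp: orthonormal_columns_def zs norm_eq_1)
  obtain j where j: "1 / real CARD('n) \<le> (z $ j)\<^sup>2"
    using ex_large_component[OF z1] by blast
  then have "z $ j \<noteq> 0" by auto
  from tau_bar_room[OF x this c(2)]
  obtain v where v: "v \<in> {z, - z}" "ereal c \<le> tau_bar xL xU x v j * ereal \<bar>v $ j\<bar>"
    by blast
  have v': "norm v = 1" "v \<in> set Z \<or> - v \<in> set Z" "1 / real CARD('n) \<le> (v $ j)\<^sup>2"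
    using v(1) z1 j by (auto simp: zs)
  obtain \<tau>p \<tau>m where \<tau>: "opt_step xL xU x p \<Delta> Z z \<tau>p" "opt_step xL xU x p \<Delta> Z (- z) \<tau>m"
    and rest: "add_loop xL xU x p \<Delta> Z zs
      (improve Z (improve Z d (proj_step xL xU x z \<tau>p)) (proj_step xL xU x (- z) \<tau>m)) d'"
    \<comment> \<open>Only the second \<open>Z\<close>, the list of columns still to be visited, is
      unfolded; the \<open>Z\<close> inside \<open>Upsilon\<close> stays intact.\<close>
    using loop by (subst (asm) (2) zs) auto
  let ?e = "improve Z (improve Z d (proj_step xL xU x z \<tau>p)) (proj_step xL xU x (- z) \<tau>m)"
  obtain \<tau> where \<tau>v: "opt_step xL xU x p \<Delta> Z v \<tau>"
    and "extend_inf (Upsilon Z) (proj_step xL xU x v \<tau>) \<le> extend_inf (Upsilon Z) ?e"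
  proof (cases "v = z")
    case True
    then show ?thesis using that[of \<tau>p] \<tau>(1)
        order_trans[OF improve_ge(2) improve_ge(1), of Z "proj_step xL xU x z \<tau>p"] by simp
  next
    case False
    then show ?thesis using that[of \<tau>m] \<tau>(2) v(1) improve_ge(2)[of Z "proj_step xL xU x (- z) \<tau>m"] by blast
  qed
  note this(2)
  also have "extend_inf (Upsilon Z) ?e \<le> extend_inf (Upsilon Z) d'"
    using add_loop_invariant[OF rest, of "\<lambda>_. True"] by simp
  finally have "extend_inf (Upsilon Z) (proj_step xL xU x v \<tau>) \<le> extend_inf (Upsilon Z) d'" .
  moreover have "0 < 1 / real CARD('n)" by simp
  from Upsilon_opt_step_ge[OF x p \<Delta> \<tau>v v'(1,2) \<kappa> this v'(3) c(1) v(2)]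
  have "ereal ((1 / CARD('n) * min c (\<Delta> / \<kappa>))\<^sup>2)
    \<le> extend_inf (Upsilon Z) (proj_step xL xU x v \<tau>)" .
  ultimately show ?thesis by (rule order_trans[rotated])
qed

text \<open>Splits the hypothesis on \<xi> into its two halves, with \<open>K\<close> standing for 1
  / \<kappa>. The second half is turned into a lower bound on each width, which makes sense for
  infinite widths too, and is weakened from the maximal radius to \<Delta>.\<close>

lemma width_bound:
  fixes xL xU :: "ereal ^ 'n"
  assumes \<Delta>: "0 < \<Delta>" "\<Delta> \<le> \<Delta>max" and "0 < \<xi>"
    and \<xi>: "ereal \<xi> \<le> ereal (1 / real CARD('n)) *
         min (ereal K) (Min (range (\<lambda>j. xU $ j - xL $ j)) / ereal (2 * \<Delta>max))"
  shows "\<xi> \<le> 1 / real CARD('n) * K"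
    "ereal (2 * (real CARD('n) * \<xi> * \<Delta>)) \<le> xU $ j - xL $ j"
proof -
  define W where "W = Min (range (\<lambda>j. xU $ j - xL $ j))"
  have W: "W \<le> xU $ j - xL $ j"
    unfolding W_def by (rule Min_le) auto
  have n: "0 < real CARD('n)" by simp
  have le: "ereal \<xi> \<le> ereal (1 / real CARD('n)) * t"
    if "min (ereal K) (W / ereal (2 * \<Delta>max)) \<le> t" for t
    using order_trans[OF \<xi>[folded W_def] ereal_mult_left_mono[OF that, of "ereal (1 / real CARD('n))"]]
    by simp
  show "\<xi> \<le> 1 / real CARD('n) * K"
    using le[of "ereal K"] by simp
  have "ereal \<xi> \<le> ereal (1 / real CARD('n)) * (W / ereal (2 * \<Delta>max))"
    using le by simp
  then have "ereal (2 * (real CARD('n) * \<xi> * \<Delta>max)) \<le> W"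
    using n \<Delta> by (cases W) (auto simp: field_simps)
  moreover have "2 * (real CARD('n) * \<xi> * \<Delta>) \<le> 2 * (real CARD('n) * \<xi> * \<Delta>max)"
    using assms by (simp add: mult_left_mono)
  ultimately show "ereal (2 * (real CARD('n) * \<xi> * \<Delta>)) \<le> xU $ j - xL $ j"
    using W by (meson ereal_less_eq(3) order_trans)
qed

text \<open>Since the procedures are relations, existence of a result is proved as well, so that the
  claim about all results is not vacuous.\<close>

theorem theorem3p5:
  fixes xL xU :: "ereal ^ 'n"
    and x :: "real ^ 'n"
    and tr \<kappa> \<Delta> \<Delta>max \<xi> :: real
    and D :: "(real ^ 'n) set"
    and Z :: "(real ^ 'n) list"
  assumes xL: "\<forall>j. xL $ j \<noteq> \<infinity>"
    and xU: "\<forall>j. xU $ j \<noteq> -\<infinity>"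
    and xL_xU: "\<forall>j. xL $ j < xU $ j"
    and x: "x \<in> box_domain xL xU"
    and \<Delta>: "0 < \<Delta>" "\<Delta> \<le> \<Delta>max"
    and tr: "1 \<le> tr"
    and \<kappa>: "0 < \<kappa>" "\<forall>v :: real ^ 'n. lp_norm tr v \<le> \<kappa> * norm v"
    and D: "finite D" "0 \<in> D"
    and Z: "orthonormal_complement D Z" "1 \<le> length Z"
    and \<xi>: "0 < \<xi>"
      "ereal \<xi> \<le> ereal (1 / real CARD('n)) *
         min (ereal (1 / \<kappa>)) (Min (range (\<lambda>j. xU $ j - xL $ j)) / ereal (2 * \<Delta>max))"
  shows "(\<exists>d D' Z'. add_direction xL xU x tr \<Delta> D Z d D' Z') \<and>
    (\<forall>d D' Z'. add_direction xL xU x tr \<Delta> D Z d D' Z' \<longrightarrow>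
       (\<exists>d\<^sub>r :: real ^ 'n. d = ereal_vec d\<^sub>r \<and> D' = insert d\<^sub>r D \<and>
          norm (orth_proj Z ((1 / \<Delta>) *\<^sub>R d\<^sub>r)) \<ge> \<xi> \<and>
          lp_norm tr d\<^sub>r \<le> \<Delta> \<and>
          x + d\<^sub>r \<in> box_domain xL xU))"
proof (intro conjI allI impI)
  have p: "0 < tr" and \<Delta>0: "0 \<le> \<Delta>" using tr \<Delta> by auto
  obtain d where "add_loop xL xU x tr \<Delta> Z Z 0 d"
    using ex_add_loop[OF x p \<Delta>0] by blast
  moreover obtain Z' where "orthonormal_complement (insert (real_vec d) D) Z'"
    using ex_orthonormal_complement by blast
  ultimately show "\<exists>d D' Z'. add_direction xL xU x tr \<Delta> D Z d D' Z'"
    by (auto simp: add_direction_def)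
next
  fix d D' Z'
  have p: "0 < tr" and \<Delta>0: "0 \<le> \<Delta>" using tr \<Delta> by auto
  assume "add_direction xL xU x tr \<Delta> D Z d D' Z'"
  then have loop: "add_loop xL xU x tr \<Delta> Z Z 0 d" and D': "D' = insert (real_vec d) D"
    by (auto simp: add_direction_def)
  \<comment> \<open>The starting value of the loop satisfies the feasibility invariant.\<close>
  have "0 = ereal_vec (0 :: real ^ 'n) \<and> lp_norm tr (0 :: real ^ 'n) \<le> \<Delta> \<and> x + 0 \<in> box_domain xL xU"
    using x \<Delta>0 by (simp add: ereal_vec_zero)
  then obtain a where a: "d = ereal_vec a" "lp_norm tr a \<le> \<Delta>" "x + a \<in> box_domain xL xU"
    using add_loop_invariant[OF loop, of "\<lambda>d. \<exists>a. d = ereal_vec a \<and> lp_norm tr a \<le> \<Delta> \<and>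
      x + a \<in> box_domain xL xU"] opt_step_result[OF x p \<Delta>0] by blast
  have Z1: "orthonormal_columns Z" and Z2: "Z \<noteq> []"
    using Z by (auto simp: orthonormal_complement_def)
  have \<xi>\<kappa>: "\<xi> \<le> 1 / real CARD('n) * (1 / \<kappa>)"
    using width_bound(1)[OF \<Delta> \<xi>] .
  \<comment> \<open>Chosen so that \<open>c\<close> divided by the dimension is \<xi> \<Delta>. The
    two halves of the hypothesis on \<xi> say that every width is at least \<open>2 * c\<close> and
    that \<open>c\<close> is at most \<Delta> / \<kappa>, so the minimum below equals
    \<open>c\<close>.\<close>
  define c where "c = real CARD('n) * \<xi> * \<Delta>"
  have "0 \<le> c" using \<xi>(1) \<Delta>0 by (simp add: c_def)
  then have "ereal ((1 / CARD('n) * min c (\<Delta> / \<kappa>))\<^sup>2) \<le> extend_inf (Upsilon Z) d"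
    using \<kappa> width_bound(2)[OF \<Delta> \<xi>]
    by (intro add_loop_Upsilon_ge[OF x p \<Delta>0 _ _ Z1 Z2 _ _ loop]) (auto simp: c_def)
  moreover have "c \<le> \<Delta> / \<kappa>"
    using mult_right_mono[OF \<xi>\<kappa>, of "real CARD('n) * \<Delta>"] \<Delta>0 by (simp add: c_def mult_ac)
  ultimately have "(\<xi> * \<Delta>)\<^sup>2 \<le> Upsilon Z a"
    by (simp add: c_def a(1) min_absorb1)
  also have "\<dots> = (norm (orth_proj Z a))\<^sup>2"
    using norm_orth_proj[OF Z1] by simp
  finally have "\<xi> * \<Delta> \<le> norm (orth_proj Z a)"
    by (rule power2_le_imp_le) simp
  moreover have "orth_proj Z ((1 / \<Delta>) *\<^sub>R a) = (1 / \<Delta>) *\<^sub>R orth_proj Z a"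
    by (simp add: orth_proj_eq_sum[OF Z1] scaleR_right.sum)
  ultimately have "\<xi> \<le> norm (orth_proj Z ((1 / \<Delta>) *\<^sub>R a))"
    using \<Delta>(1) by (simp add: field_simps)
  with a D' show "\<exists>d\<^sub>r :: real ^ 'n. d = ereal_vec d\<^sub>r \<and> D' = insert d\<^sub>r D \<and>
          norm (orth_proj Z ((1 / \<Delta>) *\<^sub>R d\<^sub>r)) \<ge> \<xi> \<and>
          lp_norm tr d\<^sub>r \<le> \<Delta> \<and>
          x + d\<^sub>r \<in> box_domain xL xU"
    by (intro exI[of _ a]) simp
qed

end
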